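(* Let $n\ge 1$, let $\mathcal{M}$ be the algebra of all complex $n\times n$ matrices, and let $\Phi:\mathcal{M}\to\mathcal{M}$ be a linear map. Then $\Phi$ preserves the extreme points of the unit ball of $\mathcal{M}$ if and only if there are unitary matrices $U,V\in\mathcal{M}$ such that $\Phi$ is either of the form $$\Phi(A)=UAV\qquad (A\in\mathcal{M})$$ or of the form $$\Phi(A)=UA^{tr}V\qquad (A\in\mathcal{M}),$$ where ${}^{tr}$ denotes the transpose.
   Context: Linear means complex-linear. $\mathcal{M}$ is equipped with the operator norm induced by the Euclidean norm on $\mathbb{C}^n$, and its unit ball is $\{A\in\mathcal{M}:\|A\|\le 1\}$. A linear map $\Phi:\mathcal{M}\to\mathcal{M}$ preserves the extreme points of the unit ball if $\Phi(A)$ is an extreme point of the unit ball whenever $A$ is one. The "either ... or" is not exclusive. *)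

theory Defs
  imports "HOL-Analysis.Analysis"
begin

text \<open>For matrices, the library operator \<open>(*s)\<close> takes row vectors rather than complex
  numbers as scalars, so complex scalar multiplication of matrices is defined separately.\<close>

definition cmat_scale :: "complex \<Rightarrow> complex^'n^'m \<Rightarrow> complex^'n^'m" where
  "cmat_scale c A = (\<chi> i j. c * A $ i $ j)"

lemma vector_space_cmat_scale: "vector_space cmat_scale"
  by unfold_locales (simp_all add: cmat_scale_def vec_eq_iff algebra_simps)

definition cmat_adjoint :: "complex^'n^'m \<Rightarrow> complex^'m^'n" where
  "cmat_adjoint A = (\<chi> i j. cnj (A $ j $ i))"

definition unitary_matrix :: "complex^'n^'n \<Rightarrow> bool" where
  "unitary_matrix U \<longleftrightarrow> cmat_adjoint U ** U = mat 1 \<and> U ** cmat_adjoint U = mat 1"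

text \<open>The instance \<open>norm\<close> on matrices is the Frobenius norm, whereas \<open>norm\<close> on
  \<open>complex^'n\<close> is the Euclidean norm. The operator norm is therefore the
  \<^const>\<open>onorm\<close> of the induced map on vectors.\<close>

definition op_unit_ball :: "(complex^'n^'n) set" where
  "op_unit_ball = {A. onorm (\<lambda>x. A *v x) \<le> 1}"

definition preserves_extreme_points :: "(complex^'n^'n \<Rightarrow> complex^'n^'n) \<Rightarrow> bool" where
  "preserves_extreme_points \<Phi> \<longleftrightarrow>
     (\<forall>A. A extreme_point_of op_unit_ball \<longrightarrow> \<Phi> A extreme_point_of op_unit_ball)"

end

theory Submission
  imports Defs
begin

text \<open>The extreme points of the unit ball are exactly the unitaries, so \<open>\<Phi>\<close> preserves unitaries, and
  multiplying by \<open>\<Phi>(I)\<^sup>*\<close> one may assume \<open>\<Phi>(I) = I\<close>. Applying \<open>\<Phi>\<close> to the unitaries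
  \<open>I + (z - 1) P\<close> with \<open>z = -1, \<i>\<close> shows that it maps projections to projections; hence
  \<open>\<Phi>(v v\<^sup>*)\<^sup>2 = \<parallel>v\<parallel>\<^sup>2 \<Phi>(v v\<^sup>*)\<close> for every vector \<open>v\<close>. The \<open>\<Phi>(E\<^sub>i\<^sub>i)\<close> are mutually orthogonal nonzero
  projections, so after a unitary conjugation \<open>\<Phi>(E\<^sub>i\<^sub>i) = E\<^sub>i\<^sub>i\<close>. Expanding the square identity at
  \<open>v = e\<^sub>i + s e\<^sub>j\<close> gives that \<open>\<Phi>(E\<^sub>i\<^sub>j)\<close> is a unimodular multiple of either \<open>E\<^sub>i\<^sub>j\<close> or \<open>E\<^sub>j\<^sub>i\<close>, and at
  \<open>v = e\<^sub>i + y e\<^sub>j + z e\<^sub>k\<close> that the same alternative holds for all pairs and that the multipliers form a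
  cocycle. A cocycle is a coboundary, so the multipliers come from conjugation by a diagonal unitary.\<close>

subsection \<open>Complex matrices and the adjoint\<close>

lemma cmat_scale_component [simp]: "cmat_scale c A $ i $ j = c * A $ i $ j"
  by (simp add: cmat_scale_def)

lemma cmat_adjoint_component [simp]: "cmat_adjoint A $ i $ j = cnj (A $ j $ i)"
  by (simp add: cmat_adjoint_def)

lemma cmat_eqI: "(\<And>i j. A $ i $ j = B $ i $ j) \<Longrightarrow> A = B"
  by (simp add: vec_eq_iff)

lemma matrix_mult_component: "(A ** B) $ i $ j = (\<Sum>k\<in>UNIV. A $ i $ k * B $ k $ j)"
  by (simp add: matrix_matrix_mult_def)

lemma matrix_mult_cmat_scale_left: "cmat_scale c A ** B = cmat_scale c (A ** B)"
  by (rule cmat_eqI) (simp add: matrix_mult_component sum_distrib_left mult.assoc)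

lemma matrix_mult_cmat_scale_right: "A ** cmat_scale c B = cmat_scale c (A ** B)"
  by (rule cmat_eqI) (simp add: matrix_mult_component sum_distrib_left mult_ac)

lemma matrix_mult_add_left: "(A + B) ** C = A ** C + B ** C"
  for A B :: "complex^'m^'n"
  by (rule cmat_eqI) (simp add: matrix_mult_component sum.distrib distrib_right)

lemma cmat_scale_scale [simp]: "cmat_scale a (cmat_scale b A) = cmat_scale (a * b) A"
  by (rule cmat_eqI) simp

lemma cmat_scale_one [simp]: "cmat_scale 1 A = A"
  by (rule cmat_eqI) simp

lemma cmat_scale_add: "cmat_scale c (A + B) = cmat_scale c A + cmat_scale c B"
  by (rule cmat_eqI) (simp add: distrib_left)

lemma cmat_adjoint_mult: "cmat_adjoint (A ** B) = cmat_adjoint B ** cmat_adjoint A"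
  by (rule cmat_eqI) (simp add: matrix_mult_component mult.commute)

lemma cmat_adjoint_adjoint [simp]: "cmat_adjoint (cmat_adjoint A) = A"
  by (rule cmat_eqI) simp

lemma cmat_adjoint_add: "cmat_adjoint (A + B) = cmat_adjoint A + cmat_adjoint B"
  by (rule cmat_eqI) simp

lemma cmat_adjoint_scale: "cmat_adjoint (cmat_scale c A) = cmat_scale (cnj c) (cmat_adjoint A)"
  by (rule cmat_eqI) simp

lemma cmat_adjoint_mat_1 [simp]: "cmat_adjoint (mat 1) = mat 1"
  by (rule cmat_eqI) (simp add: mat_def)

lemma unitary_matrixI: "cmat_adjoint U ** U = mat 1 \<Longrightarrow> unitary_matrix U"
  using matrix_left_right_inverse unitary_matrix_def by blast

lemma unitary_matrix_mult:
  assumes "unitary_matrix U" "unitary_matrix V"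
  shows "unitary_matrix (U ** V)"
proof (rule unitary_matrixI)
  have "cmat_adjoint (U ** V) ** (U ** V) = cmat_adjoint V ** (cmat_adjoint U ** U) ** V"
    by (simp add: cmat_adjoint_mult matrix_mul_assoc)
  then show "cmat_adjoint (U ** V) ** (U ** V) = mat 1"
    using assms by (simp add: unitary_matrix_def)
qed

lemma unitary_matrix_adjoint: "unitary_matrix U \<Longrightarrow> unitary_matrix (cmat_adjoint U)"
  by (simp add: unitary_matrix_def)

lemma unitary_matrix_transpose:
  assumes "unitary_matrix U"
  shows "unitary_matrix (transpose U)"
proof (rule unitary_matrixI)
  have "cmat_adjoint (transpose U) = transpose (cmat_adjoint U)"
    by (rule cmat_eqI) (simp add: transpose_def)
  then have "cmat_adjoint (transpose U) ** transpose U = transpose (U ** cmat_adjoint U)"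
    by (simp add: matrix_transpose_mul)
  then show "cmat_adjoint (transpose U) ** transpose U = mat 1"
    using assms by (simp add: unitary_matrix_def)
qed

subsection \<open>The complex inner product\<close>

text \<open>The instance inner product is only the real part of this form. Splitting off a complex
  line and its orthogonal complement takes the full Hermitian form, linear here in the first
  argument.\<close>

definition cinner :: "complex^'n \<Rightarrow> complex^'n \<Rightarrow> complex" where
  "cinner x y = (\<Sum>i\<in>UNIV. x $ i * cnj (y $ i))"

lemma inner_eq_Re_cinner: "x \<bullet> y = Re (cinner x y)"
  by (simp add: cinner_def inner_vec_def inner_complex_def)

lemma cinner_self: "cinner x x = complex_of_real ((norm x)\<^sup>2)"
  by (simp add: complex_eq_iff power2_norm_eq_inner inner_eq_Re_cinner) (simp add: cinner_def mult.commute)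

lemma cinner_smult_left: "cinner (c *s x) y = c * cinner x y"
  by (simp add: cinner_def sum_distrib_left mult.assoc)

lemma cinner_smult_right: "cinner x (c *s y) = cnj c * cinner x y"
  by (simp add: cinner_def sum_distrib_left mult_ac)

lemma cinner_diff_left: "cinner (x - y) z = cinner x z - cinner y z"
  by (simp add: cinner_def sum_subtractf left_diff_distrib)

lemma cinner_adjoint: "cinner (A *v x) y = cinner x (cmat_adjoint A *v y)"
  unfolding cinner_def matrix_vector_mult_def
  by (simp add: sum_distrib_left sum_distrib_right) (subst sum.swap, simp add: mult_ac)

lemma inner_adjoint: "(A *v x) \<bullet> y = x \<bullet> (cmat_adjoint A *v y)"
  by (simp add: inner_eq_Re_cinner cinner_adjoint)

lemma norm_vector_smult: "norm (c *s x) = cmod c * norm (x :: complex^'n)"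
  by (simp add: norm_vec_def norm_mult L2_set_right_distrib)

lemma matrix_vector_mult_smult: "A *v (c *s x) = c *s (A *v x)" for x :: "complex^'n"
  by (simp add: vec_eq_iff matrix_vector_mult_def sum_distrib_left mult_ac)

lemma scaleR_mult_vector: "(r *\<^sub>R A) *v x = r *\<^sub>R (A *v x)" for x :: "complex^'n"
  by (simp add: vec_eq_iff matrix_vector_mult_def scaleR_sum_right)

lemma mult_vector_scaleR: "A *v (r *\<^sub>R x) = r *\<^sub>R (A *v x)" for x :: "complex^'n"
  by (simp add: vec_eq_iff matrix_vector_mult_def scaleR_sum_right)

lemma unitary_matrix_norm:
  assumes "unitary_matrix U"
  shows "norm (U *v x) = norm x"
proof -
  have "(U *v x) \<bullet> (U *v x) = x \<bullet> x"
    using assms by (simp add: inner_adjoint matrix_vector_mul_assoc unitary_matrix_def)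
  then show ?thesis by (simp add: norm_eq_sqrt_inner)
qed

text \<open>Polarization turns preservation of norms into preservation of the real inner product,
  which already separates vectors.\<close>

lemma isometry_imp_unitary_matrix:
  assumes iso: "\<And>x. norm (A *v x) = norm x"
  shows "unitary_matrix A"
proof (rule unitary_matrixI)
  have inner: "(A *v x) \<bullet> (A *v y) = x \<bullet> y" for x y
    using iso[of "x + y"] iso[of x] iso[of y]
    by (simp add: dot_norm matrix_vector_right_distrib)
  have "(cmat_adjoint A ** A) *v y = mat 1 *v y" for y
  proof -
    have "x \<bullet> ((cmat_adjoint A ** A) *v y) = x \<bullet> y" for x
      using inner[of x y] by (simp add: inner_adjoint matrix_vector_mul_assoc)
    then show ?thesis
      by (metis matrix_vector_mul_lid vector_eq_ldot)
  qed
  then show "cmat_adjoint A ** A = mat 1"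
    by (simp add: matrix_eq)
qed

subsection \<open>Extreme points are unitary\<close>

lemma op_unit_ball_iff: "A \<in> op_unit_ball \<longleftrightarrow> (\<forall>x. norm (A *v x) \<le> norm x)"
proof
  assume "A \<in> op_unit_ball"
  then have le: "onorm ((*v) A) \<le> 1" by (simp add: op_unit_ball_def)
  show "\<forall>x. norm (A *v x) \<le> norm x"
  proof
    fix x
    have "norm (A *v x) \<le> onorm ((*v) A) * norm x"
      by (rule onorm) simp
    also have "\<dots> \<le> norm x"
      using mult_right_mono[OF le, of "norm x"] by simp
    finally show "norm (A *v x) \<le> norm x" .
  qed
next
  assume "\<forall>x. norm (A *v x) \<le> norm x"
  then show "A \<in> op_unit_ball"
    unfolding op_unit_ball_def by (auto intro!: onorm_bound)
qed

text \<open>Quantitative strict convexity of a Euclidean norm: the last term is the loss incurred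
  when \<open>b\<close> and \<open>c\<close> differ.\<close>

lemma norm_convex_comb_power2:
  fixes b c :: "'a::real_inner"
  shows "(norm ((1 - u) *\<^sub>R b + u *\<^sub>R c))\<^sup>2 =
    (1 - u) * (norm b)\<^sup>2 + u * (norm c)\<^sup>2 - u * (1 - u) * (norm (b - c))\<^sup>2"
  unfolding power2_norm_eq_inner
  by (simp add: inner_add inner_diff inner_commute power2_eq_square algebra_simps)

text \<open>For each \<open>x\<close>, \<open>U *v x\<close> has full length \<open>norm x\<close>
  but is a convex combination of \<open>B *v x\<close> and \<open>C *v x\<close>, which are no
  longer than that. The loss term of \<open>norm_convex_comb_power2\<close> must vanish, so
  \<open>B\<close> and \<open>C\<close> agree on every vector.\<close>

lemma unitary_matrix_imp_extreme:
  assumes U: "unitary_matrix U"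
  shows "U extreme_point_of op_unit_ball"
  unfolding extreme_point_of_def
proof (intro conjI ballI notI)
  show "U \<in> op_unit_ball"
    by (simp add: op_unit_ball_iff unitary_matrix_norm[OF U])
  fix B C assume B: "B \<in> op_unit_ball" and C: "C \<in> op_unit_ball" and "U \<in> open_segment B C"
  then obtain u where "B \<noteq> C" and u: "0 < u" "u < 1" and Ueq: "U = (1 - u) *\<^sub>R B + u *\<^sub>R C"
    by (auto simp: in_segment)
  have "B *v x = C *v x" for x
  proof -
    have "norm (B *v x) \<le> norm x" "norm (C *v x) \<le> norm x"
      using B C by (auto simp: op_unit_ball_iff)
    then have le: "(norm (B *v x))\<^sup>2 \<le> (norm x)\<^sup>2" "(norm (C *v x))\<^sup>2 \<le> (norm x)\<^sup>2"
      by (simp_all add: power_mono)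
    have "U *v x = (1 - u) *\<^sub>R (B *v x) + u *\<^sub>R (C *v x)"
      by (simp add: Ueq matrix_vector_mult_add_rdistrib scaleR_mult_vector)
    then have "(norm x)\<^sup>2 = (1 - u) * (norm (B *v x))\<^sup>2 + u * (norm (C *v x))\<^sup>2
        - u * (1 - u) * (norm (B *v x - C *v x))\<^sup>2"
      using norm_convex_comb_power2[of u "B *v x" "C *v x"] by (metis unitary_matrix_norm[OF U])
    also have "\<dots> \<le> (1 - u) * (norm x)\<^sup>2 + u * (norm x)\<^sup>2
        - u * (1 - u) * (norm (B *v x - C *v x))\<^sup>2"
      using le u by (intro diff_right_mono add_mono mult_left_mono) auto
    finally have "u * (1 - u) * (norm (B *v x - C *v x))\<^sup>2 \<le> 0"
      by (simp add: algebra_simps)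
    then show ?thesis
      using u by (auto simp: mult_le_0_iff)
  qed
  with \<open>B \<noteq> C\<close> show False by (simp add: matrix_eq)
qed

text \<open>A minimiser \<open>x\<close> of \<open>norm (A *v x)\<close> on the unit sphere is a right singular vector for the
  least singular value \<open>m\<close>; this is the only part of the singular value decomposition needed.\<close>

lemma least_singular_pair:
  fixes A :: "complex^'n^'n"
  obtains x v m where "norm x = 1" "norm v = 1" "0 \<le> m" "A *v x = m *\<^sub>R v"
    "cmat_adjoint A *v v = m *\<^sub>R x" "\<And>y. m * norm y \<le> norm (A *v y)"
proof -
  have "continuous_on (sphere 0 1) (\<lambda>y. norm (A *v y))"
    by (intro continuous_on_norm linear_continuous_on) simp
  moreover have "sphere (0 :: complex^'n) 1 \<noteq> {}"
    by (simp add: sphere_eq_empty)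
  ultimately obtain x where x: "x \<in> sphere 0 1"
    and min: "\<And>y. y \<in> sphere 0 1 \<Longrightarrow> norm (A *v x) \<le> norm (A *v y)"
    using continuous_attains_inf[of "sphere (0 :: complex^'n) 1" "\<lambda>y. norm (A *v y)"] by auto
  define m where "m = norm (A *v x)"
  have nx: "norm x = 1" using x by simp
  have lower: "m * norm y \<le> norm (A *v y)" for y
  proof (cases "y = 0")
    case False
    have "m \<le> norm (A *v ((1 / norm y) *\<^sub>R y))"
      unfolding m_def using False by (intro min) simp
    also have "\<dots> = norm (A *v y) / norm y"
      by (simp add: mult_vector_scaleR)
    finally show ?thesis using False by (simp add: field_simps)
  qed simp
  \<comment> \<open>Stationarity of the minimiser: a quadratic
    \<open>2 * t * p + t\<^sup>2 * q\<close> that is nonnegative for all \<open>t\<close> has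
    \<open>p = 0\<close>. Testing against every \<open>y\<close> makes \<open>x\<close> an
    eigenvector of \<open>cmat_adjoint A ** A\<close>.\<close>
  have crit: "(A *v x) \<bullet> (A *v y) = m\<^sup>2 * (x \<bullet> y)" for y
  proof -
    define p where "p = (A *v x) \<bullet> (A *v y) - m\<^sup>2 * (x \<bullet> y)"
    define q where "q = (norm (A *v y))\<^sup>2 - m\<^sup>2 * (norm y)\<^sup>2"
    have ineq: "0 \<le> 2 * t * p + t\<^sup>2 * q" for t
    proof -
      have "(m * norm (x + t *\<^sub>R y))\<^sup>2 \<le> (norm (A *v (x + t *\<^sub>R y)))\<^sup>2"
        by (intro power_mono lower) (simp add: m_def)
      moreover have "(norm (A *v (x + t *\<^sub>R y)))\<^sup>2 =
          m\<^sup>2 + 2 * t * ((A *v x) \<bullet> (A *v y)) + t\<^sup>2 * (norm (A *v y))\<^sup>2"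
        unfolding m_def matrix_vector_right_distrib mult_vector_scaleR power2_norm_eq_inner
        by (simp add: inner_add inner_commute power2_eq_square algebra_simps)
      moreover have "(norm (x + t *\<^sub>R y))\<^sup>2 = 1 + 2 * t * (x \<bullet> y) + t\<^sup>2 * (norm y)\<^sup>2"
        using nx unfolding power2_norm_eq_inner norm_eq_1
        by (simp add: inner_add inner_commute power2_eq_square algebra_simps)
      ultimately show ?thesis
        unfolding p_def q_def by (simp add: power_mult_distrib algebra_simps)
    qed
    have "p = 0"
    proof (rule ccontr)
      assume "p \<noteq> 0"
      \<comment> \<open>With this \<open>s\<close>, the step \<open>t = - s * p\<close> is short
        enough for the linear term to dominate, making the quadratic negative.\<close>
      define s where "s = 1 / (1 + \<bar>q\<bar>)"
      have s: "0 < s" "s * \<bar>q\<bar> < 1" unfolding s_def by (simp_all add: field_simps)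
      then have "s * q < 1"
        by (smt (verit) mult_left_mono)
      have "2 * (- s * p) * p + (- s * p)\<^sup>2 * q = s * p\<^sup>2 * (s * q - 2)"
        by (simp add: power2_eq_square algebra_simps)
      moreover have "s * p\<^sup>2 * (s * q - 2) < 0"
        using s \<open>s * q < 1\<close> \<open>p \<noteq> 0\<close> by (intro mult_pos_neg) auto
      ultimately show False using ineq[of "- s * p"] by linarith
    qed
    then show ?thesis by (simp add: p_def)
  qed
  have AAx: "cmat_adjoint A *v (A *v x) = m\<^sup>2 *\<^sub>R x"
    by (subst vector_eq_rdot[symmetric]) (use crit in \<open>simp add: inner_adjoint[symmetric] inner_commute\<close>)
  show thesis
  proof (cases "m = 0")
    case False
    show thesis
    proof (rule that[of x "(1 / m) *\<^sub>R (A *v x)" m])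
      show "norm ((1 / m) *\<^sub>R (A *v x)) = 1" using False by (simp add: m_def)
      show "cmat_adjoint A *v ((1 / m) *\<^sub>R (A *v x)) = m *\<^sub>R x"
        using False by (simp add: mult_vector_scaleR AAx power2_eq_square)
    qed (use nx lower False in \<open>simp_all add: m_def\<close>)
  next
    \<comment> \<open>Now \<open>A *v x = 0\<close> cannot be normalised, so \<open>v\<close> is
      taken from the kernel of the adjoint, which is nontrivial because a square matrix and its
      adjoint are singular together.\<close>
    case True
    then have "A *v x = 0" by (simp add: m_def)
    then have "\<nexists>B. B ** A = mat 1"
      using nx matrix_left_invertible_ker[of A] by auto
    then have "\<nexists>B. B ** cmat_adjoint A = mat 1"
      by (metis cmat_adjoint_mult cmat_adjoint_adjoint cmat_adjoint_mat_1 matrix_left_right_inverse)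
    then obtain w where w: "w \<noteq> 0" "cmat_adjoint A *v w = 0"
      using matrix_left_invertible_ker[of "cmat_adjoint A"] by auto
    show thesis
      using w nx lower True \<open>A *v x = 0\<close>
      by (intro that[of x "(1 / norm w) *\<^sub>R w" m]) (simp_all add: mult_vector_scaleR)
  qed
qed

definition outer_product :: "complex^'n \<Rightarrow> complex^'n \<Rightarrow> complex^'n^'n" where
  "outer_product v w = (\<chi> i j. v $ i * cnj (w $ j))"

lemma outer_product_component [simp]: "outer_product v w $ i $ j = v $ i * cnj (w $ j)"
  by (simp add: outer_product_def)

lemma outer_product_mult_vector: "outer_product v w *v y = cinner y w *s v"
  by (simp add: vec_eq_iff matrix_vector_mult_def cinner_def sum_distrib_left mult_ac)

text \<open>If the least singular value \<open>m\<close> is below 1, then \<open>A\<close> is the midpoint of \<open>A \<plusminus> (1 - m) v x\<^sup>*\<close>, which stay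
  in the ball because \<open>A\<close> maps \<open>x\<^sup>\<bottom>\<close> into \<open>v\<^sup>\<bottom>\<close>.\<close>

lemma extreme_imp_unitary_matrix:
  fixes A :: "complex^'n^'n"
  assumes A: "A extreme_point_of op_unit_ball"
  shows "unitary_matrix A"
proof -
  have le: "norm (A *v y) \<le> norm y" for y
    using A by (simp add: extreme_point_of_def op_unit_ball_iff)
  obtain x v m where x: "norm x = 1" and v: "norm v = 1" and m: "0 \<le> m"
    and Ax: "A *v x = m *\<^sub>R v" and Av: "cmat_adjoint A *v v = m *\<^sub>R x"
    and lower: "\<And>y. m * norm y \<le> norm (A *v y)"
    using least_singular_pair[of A] by metis
  have "\<not> m < 1"
  proof
    assume "m < 1"
    define B where "B = (1 - m) *\<^sub>R outer_product v x"
    have mem: "A + s *\<^sub>R B \<in> op_unit_ball" if s: "\<bar>s\<bar> = 1" for s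
      unfolding op_unit_ball_iff
    proof
      fix y
      define c where "c = cinner y x"
      define z where "z = y - c *s x"
      \<comment> \<open>The perturbation replaces the singular value \<open>m\<close> by
        \<open>r\<close>, which is 1 or \<open>2 * m - 1\<close> according to the sign
        \<open>s\<close>; both lie in [-1, 1].\<close>
      define r where "r = m + s * (1 - m)"
      have r: "r\<^sup>2 \<le> 1"
        using s m \<open>m < 1\<close> unfolding r_def by (auto simp: abs_square_le_1 abs_le_iff abs_if split: if_splits)
      have y: "y = c *s x + z" by (simp add: z_def)
      have zx: "cinner z x = 0"
        by (simp add: z_def cinner_diff_left cinner_smult_left cinner_self x c_def)
      have Ay: "A *v y = c *s (A *v x) + A *v z"
        by (metis matrix_vector_mult_smult matrix_vector_right_distrib y)
      have "(A + s *\<^sub>R B) *v y = (c *s (A *v x) + A *v z) + (s * (1 - m)) *\<^sub>R (c *s v)"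
        by (simp add: matrix_vector_mult_add_rdistrib Ay B_def scaleR_mult_vector
            outer_product_mult_vector c_def[symmetric])
      also have "\<dots> = r *\<^sub>R (c *s v) + A *v z"
        by (simp add: Ax r_def vec_eq_iff algebra_simps)
      finally have eq: "(A + s *\<^sub>R B) *v y = r *\<^sub>R (c *s v) + A *v z" .
      \<comment> \<open>\<open>A\<close> sends the complement of \<open>x\<close> into that of
        \<open>v\<close> because the adjoint sends \<open>v\<close> to a multiple of
        \<open>x\<close>; Pythagoras then applies on both sides.\<close>
      have "(A *v z) \<bullet> (c *s v) = z \<bullet> (c *s (m *\<^sub>R x))"
        by (simp add: inner_adjoint matrix_vector_mult_smult Av)
      also have "\<dots> = m * (z \<bullet> (c *s x))"
        by (simp add: inner_eq_Re_cinner cinner_def sum_distrib_left mult_ac)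
      also have "\<dots> = 0"
        by (simp add: inner_eq_Re_cinner cinner_smult_right zx)
      finally have orth: "(A *v z) \<bullet> (c *s v) = 0" .
      have orth': "(c *s x) \<bullet> z = 0"
        by (subst inner_commute) (simp add: inner_eq_Re_cinner cinner_smult_right zx)
      have "(norm ((A + s *\<^sub>R B) *v y))\<^sup>2 = r\<^sup>2 * (cmod c)\<^sup>2 + (norm (A *v z))\<^sup>2"
        unfolding eq using orth
        by (subst norm_add_Pythagorean)
          (simp_all add: orthogonal_def inner_commute norm_vector_smult v power_mult_distrib)
      also have "\<dots> \<le> 1 * (cmod c)\<^sup>2 + (norm z)\<^sup>2"
        using r le by (intro add_mono mult_right_mono power_mono) auto
      also have "\<dots> = (norm y)\<^sup>2"
        unfolding y using orth' by (subst norm_add_Pythagorean)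
          (simp_all add: orthogonal_def norm_vector_smult x)
      finally show "norm ((A + s *\<^sub>R B) *v y) \<le> norm y"
        by (rule power2_le_imp_le) simp
    qed
    have "B *v x = (1 - m) *\<^sub>R v"
      by (simp add: B_def scaleR_mult_vector outer_product_mult_vector cinner_self x)
    then have "B \<noteq> 0"
      using v \<open>m < 1\<close> by auto
    then have "A - B \<noteq> A + B"
      by (simp add: algebra_simps scaleR_2[symmetric])
    moreover have "A = midpoint (A - B) (A + B)"
      by (simp add: midpoint_def scaleR_2[symmetric])
    ultimately have "A \<in> open_segment (A - B) (A + B)"
      by (metis midpoint_in_open_segment)
    moreover have "A - B \<in> op_unit_ball" "A + B \<in> op_unit_ball"
      using mem[of "-1"] mem[of 1] by simp_all
    ultimately show False
      using A by (simp add: extreme_point_of_def)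
  qed
  then have "norm y \<le> norm (A *v y)" for y
    using lower[of y] mult_right_mono[of 1 m "norm y"] by simp
  then show ?thesis
    using le by (intro isometry_imp_unitary_matrix antisym)
qed

lemma extreme_point_iff_unitary_matrix: "A extreme_point_of op_unit_ball \<longleftrightarrow> unitary_matrix A"
  using unitary_matrix_imp_extreme extreme_imp_unitary_matrix by blast

subsection \<open>Unital linear maps preserving unitaries\<close>

definition projection_matrix :: "complex^'n^'n \<Rightarrow> bool" where
  "projection_matrix P \<longleftrightarrow> cmat_adjoint P = P \<and> P ** P = P"

text \<open>Stated for arbitrary \<open>Q\<close> because it is read in both directions: it shows
  that reflections built from projections are unitary, and it turns unitarity of their images into
  equations for \<open>Q\<close>.\<close>

lemma reflection_product:
  "(mat 1 + cmat_scale c Q) ** cmat_adjoint (mat 1 + cmat_scale c Q) =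
    mat 1 + (cmat_scale c Q + cmat_scale (cnj c) (cmat_adjoint Q) + cmat_scale (c * cnj c) (Q ** cmat_adjoint Q))"
  by (simp add: cmat_adjoint_add cmat_adjoint_scale matrix_mult_add_left matrix_add_ldistrib
      matrix_mult_cmat_scale_left matrix_mult_cmat_scale_right cmat_scale_add add_ac mult.commute)

text \<open>The matrix acts as the unimodular scalar \<open>z\<close> on the range of
  \<open>P\<close> and as the identity on its kernel.\<close>

lemma unitary_reflection:
  assumes P: "projection_matrix P" and z: "z * cnj z = 1"
  shows "unitary_matrix (mat 1 + cmat_scale (z - 1) P)"
proof -
  have "(mat 1 + cmat_scale (z - 1) P) ** cmat_adjoint (mat 1 + cmat_scale (z - 1) P) = mat 1"
  proof (rule cmat_eqI)
    fix i j
    have "(z - 1) * p + cnj (z - 1) * p + (z - 1) * cnj (z - 1) * p = 0" for p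
      using z by (simp add: algebra_simps)
    then show "((mat 1 + cmat_scale (z - 1) P) ** cmat_adjoint (mat 1 + cmat_scale (z - 1) P)) $ i $ j
        = (mat 1 :: complex^'a^'a) $ i $ j"
      using P unfolding reflection_product by (simp add: projection_matrix_def)
  qed
  then show ?thesis
    using matrix_left_right_inverse unitary_matrix_def by blast
qed

lemma projection_matrix_outer_product:
  assumes "norm v = 1"
  shows "projection_matrix (outer_product v v)"
proof -
  have "(\<Sum>k\<in>UNIV. cnj (v $ k) * v $ k) = 1"
    using assms cinner_self[of v] by (simp add: cinner_def mult.commute)
  moreover have "(outer_product v v ** outer_product v v) $ i $ j =
      v $ i * (\<Sum>k\<in>UNIV. cnj (v $ k) * v $ k) * cnj (v $ j)" for i j
    by (simp add: matrix_mult_component sum_distrib_left sum_distrib_right mult_ac)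
  ultimately show ?thesis
    by (auto simp: projection_matrix_def intro!: cmat_eqI)
qed

text \<open>Encoded as an outer product so that the results about \<open>outer_product v v\<close>
  apply to the diagonal units directly.\<close>

definition matrix_unit :: "'n \<Rightarrow> 'n \<Rightarrow> complex^'n^'n" where
  "matrix_unit i j = outer_product (axis i 1) (axis j 1)"

lemma matrix_unit_component: "matrix_unit i j $ p $ q = (if p = i \<and> q = j then 1 else 0)"
  by (simp add: matrix_unit_def axis_def)

lemma sum_matrix_unit_diag: "(\<Sum>i\<in>UNIV. matrix_unit i i) = mat 1"
proof (rule cmat_eqI)
  fix p q :: 'a
  have "(\<Sum>i\<in>UNIV. if p = i \<and> q = i then 1 else 0) = (\<Sum>i\<in>UNIV. if p = i then (if p = q then 1 else 0) else 0 :: complex)"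
    by (intro sum.cong refl) auto
  then show "(\<Sum>i\<in>UNIV. matrix_unit i i) $ p $ q = (mat 1 :: complex^'a^'a) $ p $ q"
    by (simp add: matrix_unit_component mat_def)
qed

lemma matrix_unit_expansion:
  "A = (\<Sum>i\<in>UNIV. \<Sum>j\<in>UNIV. cmat_scale (A $ i $ j) (matrix_unit i j))"
proof (rule cmat_eqI)
  fix p q
  have "(\<Sum>j\<in>UNIV. A $ i $ j * (if p = i \<and> q = j then 1 else 0)) = (if p = i then A $ i $ q else 0)" for i
  proof -
    have "(\<Sum>j\<in>UNIV. A $ i $ j * (if p = i \<and> q = j then 1 else 0)) =
        (\<Sum>j\<in>UNIV. if q = j then (if p = i then A $ i $ j else 0) else 0)"
      by (intro sum.cong refl) auto
    then show ?thesis by simp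
  qed
  then show "A $ p $ q = (\<Sum>i\<in>UNIV. \<Sum>j\<in>UNIV. cmat_scale (A $ i $ j) (matrix_unit i j)) $ p $ q"
    by (simp add: matrix_unit_component)
qed

lemma projection_matrix_two_units:
  assumes "i \<noteq> j"
  shows "projection_matrix (matrix_unit i i + matrix_unit j j)"
  unfolding projection_matrix_def
  using assms
  by (auto intro!: cmat_eqI simp: matrix_mult_component matrix_unit_component
      if_distrib[of "\<lambda>x. x * _"] if_distrib[of "\<lambda>x. x + _"] sum.If_cases)

text \<open>Separates two quantities once their sum and difference are known, the usual outcome of
  evaluating an identity at two phases.\<close>

lemma add_diff_eq_imp_eq:
  fixes a b c d :: "'a::real_vector"
  assumes "a + b = c + d" "a - b = c - d"
  shows "a = c \<and> b = d"
proof -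
  have half: "x = (1 / 2) *\<^sub>R ((x + y) + (x - y))" "y = (1 / 2) *\<^sub>R ((x + y) - (x - y))" for x y :: 'a
    by (simp_all add: scaleR_2[symmetric])
  show ?thesis
    by (metis half assms)
qed

section \<open>Images of projections and of rank-one matrices\<close>

locale unital_unitary_preserver =
  fixes \<Phi> :: "complex^'n^'n \<Rightarrow> complex^'n^'n"
  assumes add: "\<Phi> (A + B) = \<Phi> A + \<Phi> B"
    and scale: "\<Phi> (cmat_scale c A) = cmat_scale c (\<Phi> A)"
    and one: "\<Phi> (mat 1) = mat 1"
    and unitary: "unitary_matrix U \<Longrightarrow> unitary_matrix (\<Phi> U)"
begin

lemma zero: "\<Phi> 0 = 0"
  using add[of 0 0] by simp

lemma sum: "\<Phi> (\<Sum>i\<in>I. f i) = (\<Sum>i\<in>I. \<Phi> (f i))"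
  by (induction I rule: infinite_finite_induct) (simp_all add: zero add)

lemma projection:
  assumes P: "projection_matrix P"
  shows "projection_matrix (\<Phi> P)"
proof -
  define Q where "Q = \<Phi> P"
  define R where "R = Q ** cmat_adjoint Q"
  have eq: "(z - 1) * Q $ i $ j + cnj (z - 1) * cnj (Q $ j $ i) + (z - 1) * cnj (z - 1) * R $ i $ j = 0"
    if z: "z * cnj z = 1" for z i j
  proof -
    have "unitary_matrix (mat 1 + cmat_scale (z - 1) Q)"
      using unitary[OF unitary_reflection[OF P z]] by (simp add: add scale one Q_def)
    then have "(mat 1 + cmat_scale (z - 1) Q) ** cmat_adjoint (mat 1 + cmat_scale (z - 1) Q) = mat 1"
      by (simp add: unitary_matrix_def)
    then have "cmat_scale (z - 1) Q + cmat_scale (cnj (z - 1)) (cmat_adjoint Q)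
        + cmat_scale ((z - 1) * cnj (z - 1)) R = 0"
      unfolding reflection_product R_def by (simp only: add_cancel_left_right)
    from arg_cong[OF this, of "\<lambda>M. M $ i $ j"] show ?thesis by simp
  qed
  have R: "Q $ i $ j = R $ i $ j \<and> cnj (Q $ j $ i) = R $ i $ j" for i j
  proof -
    \<comment> \<open>At each entry, \<open>z = -1\<close> gives \<open>q + q' = 2 * r\<close> and
      \<open>z = \<i>\<close> then gives \<open>q = q'\<close>, so all three coincide. Globally
      \<open>Q\<close> equals both its adjoint and \<open>Q ** cmat_adjoint Q\<close>.\<close>
    define q q' r where "q = Q $ i $ j" "q' = cnj (Q $ j $ i)" "r = R $ i $ j"
    have "(\<i> - 1) * q + (- \<i> - 1) * q' + 2 * r = 0"
      using eq[of \<i> i j] by (simp add: q_q'_r_def algebra_simps)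
    moreover have "4 * r = 2 * q + 2 * q'"
      using eq[of "-1" i j] by (simp add: q_q'_r_def algebra_simps)
    then have 1: "q + q' = 2 * r" by algebra
    moreover have "\<i> * (q - q') = ((\<i> - 1) * q + (- \<i> - 1) * q' + 2 * r) + (q + q' - 2 * r)"
      by (simp add: algebra_simps)
    ultimately have "\<i> * (q - q') = 0"
      by simp
    then have "q = q'" by simp
    with 1 show ?thesis by (simp add: q_q'_r_def)
  qed
  have "cmat_adjoint Q = Q"
    by (rule cmat_eqI) (metis R cmat_adjoint_component)
  moreover have "Q = R"
    using R by (intro cmat_eqI) simp
  ultimately show ?thesis
    unfolding projection_matrix_def Q_def[symmetric] by (metis R_def)
qed

text \<open>\<open>outer_product v v\<close> is the squared norm of \<open>v\<close> times a
  projection. Rescaling removes the normalisation of \<open>v\<close>, so that the identity can be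
  expanded in the entries of \<open>v\<close>.\<close>

lemma rank_one:
  "\<Phi> (outer_product v v) ** \<Phi> (outer_product v v) =
    cmat_scale (complex_of_real ((norm v)\<^sup>2)) (\<Phi> (outer_product v v))" (is ?square)
  "cmat_adjoint (\<Phi> (outer_product v v)) = \<Phi> (outer_product v v)" (is ?adj)
proof -
  have "?square \<and> ?adj"
  proof (cases "v = 0")
    case True
    then have "outer_product v v = 0" by (intro cmat_eqI) simp
    then show ?thesis by (simp add: zero) (auto intro: cmat_eqI)
  next
    case False
    define w where "w = (1 / complex_of_real (norm v)) *s v"
    define c where "c = complex_of_real ((norm v)\<^sup>2)"
    have "norm w = 1" using False by (simp add: w_def norm_vector_smult norm_divide)
    then have P: "projection_matrix (\<Phi> (outer_product w w))"
      by (intro projection projection_matrix_outer_product)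
    have "outer_product v v = cmat_scale c (outer_product w w)"
      using False by (intro cmat_eqI) (simp add: w_def c_def power2_eq_square)
    then have "\<Phi> (outer_product v v) = cmat_scale c (\<Phi> (outer_product w w))"
      by (simp add: scale)
    moreover have "cnj c = c" by (simp add: c_def)
    ultimately show ?thesis
      unfolding c_def[symmetric] using P
      by (simp add: projection_matrix_def cmat_adjoint_scale matrix_mult_cmat_scale_left
          matrix_mult_cmat_scale_right)
  qed
  then show ?square ?adj by simp_all
qed

abbreviation F where "F i j \<equiv> \<Phi> (matrix_unit i j)"

lemma projection_diag: "projection_matrix (F i i)"
  unfolding matrix_unit_def by (intro projection projection_matrix_outer_product) simp

text \<open>If P, Q and P + Q are projections, then PQ + QP = 0. Multiplying by P on the left and on
  the right gives PQ = -PQP = QP, hence 2PQ = 0.\<close>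

lemma diag_orthogonal:
  assumes "i \<noteq> j"
  shows "F i i ** F j j = 0"
proof -
  let ?P = "F i i" and ?Q = "F j j"
  have P: "?P ** ?P = ?P" and Q: "?Q ** ?Q = ?Q"
    using projection_diag by (simp_all add: projection_matrix_def)
  have "projection_matrix (?P + ?Q)"
    using projection[OF projection_matrix_two_units[OF assms]] by (simp add: add)
  then have "(?P + ?Q) ** (?P + ?Q) = ?P + ?Q" by (simp add: projection_matrix_def)
  then have anti: "?P ** ?Q + ?Q ** ?P = 0"
    by (simp add: matrix_mult_add_left matrix_add_ldistrib P Q) (simp add: algebra_simps)
  have "?P ** (?P ** ?Q + ?Q ** ?P) = 0" "(?P ** ?Q + ?Q ** ?P) ** ?P = 0"
    unfolding anti by (auto intro!: cmat_eqI simp: matrix_mult_component)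
  then have "?P ** ?Q + ?P ** ?Q ** ?P = 0" "?P ** ?Q ** ?P + ?Q ** ?P = 0"
    by (simp_all add: matrix_mult_add_left matrix_add_ldistrib matrix_mul_assoc P)
      (simp_all add: matrix_mul_assoc[symmetric] P)
  then have "?P ** ?Q = ?Q ** ?P"
    by (metis add.commute add_left_cancel)
  with anti have "2 *\<^sub>R (?P ** ?Q) = 0" by (simp add: scaleR_2)
  then show ?thesis by simp
qed

text \<open>Even and odd parts of the square identity for \<open>\<Phi>\<close> at the vectors \<open>e\<^sub>i \<plusminus> s e\<^sub>j\<close>.\<close>

lemma two_by_two:
  assumes "i \<noteq> j"
  defines "S \<equiv> \<lambda>s. F i i + cmat_scale (s * cnj s) (F j j)"
    and "X \<equiv> \<lambda>s. cmat_scale (cnj s) (F i j) + cmat_scale s (F j i)"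
  shows "S s ** X s + X s ** S s = cmat_scale (1 + s * cnj s) (X s)"
    and "S s ** S s + X s ** X s = cmat_scale (1 + s * cnj s) (S s)"
    and "cmat_adjoint (S s + X s) = S s + X s"
proof -
  define v where "v t = axis i 1 + t *s axis j 1" for t :: complex
  have nv: "complex_of_real ((norm (v t))\<^sup>2) = 1 + t * cnj t" for t
  proof -
    have "(\<Sum>k\<in>UNIV. v t $ k * cnj (v t $ k)) =
        (\<Sum>k\<in>UNIV. (if k = i then 1 else 0) + (if k = j then t * cnj t else 0))"
      using assms(1) by (intro sum.cong refl) (auto simp: v_def axis_def)
    also have "\<dots> = 1 + t * cnj t" by (simp add: sum.distrib)
    finally show ?thesis by (metis cinner_self cinner_def)
  qed
  have T: "\<Phi> (outer_product (v t) (v t)) = S t + X t" for t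
  proof -
    have "outer_product (v t) (v t) = matrix_unit i i + cmat_scale (t * cnj t) (matrix_unit j j)
        + (cmat_scale (cnj t) (matrix_unit i j) + cmat_scale t (matrix_unit j i))"
      by (rule cmat_eqI) (simp add: v_def matrix_unit_def algebra_simps)
    then show ?thesis by (simp add: add scale S_def X_def)
  qed
  have Sm: "S (- s) = S s" by (simp add: S_def)
  have Xm: "X (- s) = - X s" by (rule cmat_eqI) (simp add: X_def)
  have "(S s + X s) ** (S s + X s) = cmat_scale (1 + s * cnj s) (S s + X s)"
    using rank_one(1)[of "v s"] unfolding nv T .
  then have p: "S s ** S s + X s ** X s + (S s ** X s + X s ** S s) =
      cmat_scale (1 + s * cnj s) (S s) + cmat_scale (1 + s * cnj s) (X s)"
    by (simp add: matrix_mult_add_left matrix_add_ldistrib cmat_scale_add add_ac)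
  have neg: "A ** (- B) = - (A ** B)" "(- A) ** B = - (A ** B)" for A B :: "complex^'n^'n"
    by (auto intro!: cmat_eqI simp: matrix_mult_component sum_negf)
  have sneg: "cmat_scale c (- A) = - cmat_scale c A" for c and A :: "complex^'n^'n"
    by (auto intro!: cmat_eqI)
  have "(S s + - X s) ** (S s + - X s) = cmat_scale (1 + s * cnj s) (S s + - X s)"
    using rank_one(1)[of "v (- s)"] unfolding nv T Sm Xm by simp
  then have m: "S s ** S s + X s ** X s - (S s ** X s + X s ** S s) =
      cmat_scale (1 + s * cnj s) (S s) - cmat_scale (1 + s * cnj s) (X s)"
    by (simp only: matrix_mult_add_left matrix_add_ldistrib cmat_scale_add neg sneg) (simp add: algebra_simps)
  show "S s ** X s + X s ** S s = cmat_scale (1 + s * cnj s) (X s)"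
    and "S s ** S s + X s ** X s = cmat_scale (1 + s * cnj s) (S s)"
    using add_diff_eq_imp_eq[OF p m] by simp_all
  show "cmat_adjoint (S s + X s) = S s + X s"
    using rank_one(2)[of "v s"] by (simp add: T)
qed

text \<open>With \<open>F i i = 0\<close>, the odd identity of \<open>two_by_two\<close> at
  \<open>s = 1\<close> and at \<open>s = 2\<close> puts the incompatible factors 2 and 5/4 in front
  of \<open>X\<close>, so \<open>X = 0\<close>. The even identity then reads
  \<open>?Q = cmat_scale 2 ?Q\<close>.\<close>

lemma diag_zero_imp:
  assumes zero: "F i i = 0" and "i \<noteq> j"
  shows "F j j = 0"
proof -
  let ?Q = "F j j"
  define X where "X = F i j + F j i"
  have Q: "?Q ** ?Q = ?Q"
    using projection_diag by (simp add: projection_matrix_def)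
  have "?Q ** X + X ** ?Q = cmat_scale 2 X" and QX: "?Q ** ?Q + X ** X = cmat_scale 2 ?Q"
    using two_by_two(1,2)[OF \<open>i \<noteq> j\<close>, of 1] by (simp_all add: zero X_def)
  then have 1: "(?Q ** X) $ p $ q + (X ** ?Q) $ p $ q = 2 * X $ p $ q" for p q
    by (metis cmat_scale_component vector_add_component)
  have "cmat_scale 8 (?Q ** X) + cmat_scale 8 (X ** ?Q) = cmat_scale 10 X"
    using two_by_two(1)[OF \<open>i \<noteq> j\<close>, of 2]
    by (simp add: zero X_def cmat_scale_add[symmetric] matrix_mult_cmat_scale_left matrix_mult_cmat_scale_right)
  then have 2: "8 * (?Q ** X) $ p $ q + 8 * (X ** ?Q) $ p $ q = 10 * X $ p $ q" for p q
    by (metis cmat_scale_component vector_add_component)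
  have "X = 0"
  proof (rule cmat_eqI)
    fix p q
    have "8 * (2 * X $ p $ q) = 10 * X $ p $ q"
      unfolding 1[symmetric] 2[symmetric] by (simp add: algebra_simps)
    then show "X $ p $ q = 0 $ p $ q" by simp
  qed
  with QX Q have "?Q = cmat_scale 2 ?Q" by simp
  then have "?Q $ p $ q = 2 * ?Q $ p $ q" for p q
    by (metis cmat_scale_component)
  then show ?thesis by (intro cmat_eqI) simp
qed

text \<open>One vanishing image would make all of them vanish, although they sum to the
  identity.\<close>

lemma diag_nonzero: "F i i \<noteq> 0"
proof
  assume "F i i = 0"
  then have "F j j = 0" for j
    using diag_zero_imp by (cases "i = j") auto
  then have "\<Phi> (\<Sum>j\<in>UNIV. matrix_unit j j) = 0"
    by (simp add: sum)
  then have "(mat 1 :: complex^'n^'n) = 0"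
    by (simp add: sum_matrix_unit_diag one)
  then have "(mat 1 :: complex^'n^'n) $ i $ i = 0" by simp
  then show False by (simp add: mat_def)
qed

text \<open>Choosing a unit vector in the range of each of the mutually orthogonal nonzero
  projections gives as many orthonormal vectors as the dimension; these are the columns of
  \<open>W\<close>. Each \<open>F i i\<close> fixes its own column and kills the others, so it has
  rank one.\<close>

lemma diag_simultaneously_diagonalizable:
  obtains W where "unitary_matrix W" "\<And>i. cmat_adjoint W ** F i i ** W = matrix_unit i i"
proof -
  have "\<exists>f. norm f = 1 \<and> F i i *v f = f" for i
  proof -
    obtain y where y: "F i i *v y \<noteq> 0"
      using diag_nonzero[of i] matrix_eq[of "F i i" 0] by auto
    have "F i i *v (F i i *v y) = F i i *v y"
      using projection_diag[of i] by (simp add: matrix_vector_mul_assoc projection_matrix_def)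
    then show ?thesis
      using y by (intro exI[of _ "(1 / norm (F i i *v y)) *\<^sub>R (F i i *v y)"]) (simp add: mult_vector_scaleR)
  qed
  then obtain f where f: "\<And>i. norm (f i) = 1" "\<And>i. F i i *v f i = f i"
    by metis
  have f0: "F i i *v f j = 0" if "i \<noteq> j" for i j
    using diag_orthogonal[OF that] f(2)[of j] by (metis matrix_vector_mul_assoc matrix_vector_mult_0)
  have orth: "cinner (f j) (f i) = (if i = j then 1 else 0)" for i j
  proof (cases "i = j")
    case True
    then show ?thesis by (simp add: cinner_self f)
  next
    case False
    have "cinner (f j) (f i) = cinner (F j j *v f j) (f i)" by (simp add: f)
    also have "\<dots> = cinner (f j) (F j j *v f i)"
      using projection_diag[of j] by (simp add: cinner_adjoint projection_matrix_def)
    also have "\<dots> = 0" using False by (simp add: f0 cinner_def)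
    finally show ?thesis using False by simp
  qed
  define W :: "complex^'n^'n" where "W = (\<chi> p q. f q $ p)"
  have W: "cmat_adjoint W ** W = mat 1"
  proof (rule cmat_eqI)
    fix i j
    have "(cmat_adjoint W ** W) $ i $ j = cinner (f j) (f i)"
      by (simp add: W_def matrix_mult_component cinner_def mult.commute)
    then show "(cmat_adjoint W ** W) $ i $ j = (mat 1 :: complex^'n^'n) $ i $ j"
      by (simp add: orth mat_def)
  qed
  have "F i i ** W = W ** matrix_unit i i" for i
  proof (rule cmat_eqI)
    fix p q
    have "(F i i ** W) $ p $ q = (F i i *v f q) $ p"
      by (simp add: W_def matrix_mult_component matrix_vector_mult_def)
    also have "\<dots> = (if q = i then f q $ p else 0)"
      using f(2) f0 by (metis zero_index)
    also have "\<dots> = (W ** matrix_unit i i) $ p $ q"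
      by (simp add: W_def matrix_mult_component matrix_unit_component if_distrib cong: if_cong)
    finally show "(F i i ** W) $ p $ q = (W ** matrix_unit i i) $ p $ q" .
  qed
  then have "cmat_adjoint W ** F i i ** W = matrix_unit i i" for i
    by (metis W matrix_mul_assoc matrix_mul_lid)
  then show thesis
    using that unitary_matrixI[OF W] by blast
qed

end

section \<open>Diagonal matrices and cocycles\<close>

lemma matrix_unit_mult_left: "(matrix_unit i i ** A) $ p $ q = (if p = i then A $ p $ q else 0)"
  by (simp add: matrix_mult_component matrix_unit_component if_distrib[of "\<lambda>x. x * _"] cong: if_cong)

lemma matrix_unit_mult_right: "(A ** matrix_unit i i) $ p $ q = (if q = i then A $ p $ q else 0)"
  by (simp add: matrix_mult_component matrix_unit_component if_distrib[of "\<lambda>x. _ * x"] cong: if_cong)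

text \<open>Fixing a base index \<open>k\<close> splits the cocycle as
  \<open>c p q = c p k * c k q\<close>; the diagonal matrix with entries \<open>c p k\<close> is the
  coboundary, unitary because \<open>c p k * c k p = 1\<close>.\<close>

lemma cocycle_Hadamard_conjugation:
  fixes c :: "'n::finite \<Rightarrow> 'n \<Rightarrow> complex"
  assumes refl: "\<And>p. c p p = 1" and trans: "\<And>p q r. c p q * c q r = c p r"
    and adj: "\<And>p q. cnj (c p q) = c q p"
  obtains D where "unitary_matrix D"
    "\<And>A. (\<chi> p q. A $ p $ q * c p q) = D ** A ** cmat_adjoint D"
proof -
  fix k :: 'n
  define D :: "complex^'n^'n" where "D = (\<chi> p q. if p = q then c p k else 0)"
  have left: "(D ** A) $ p $ q = c p k * A $ p $ q" for A :: "complex^'n^'n" and p q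
    by (simp add: D_def matrix_mult_component if_distrib[of "\<lambda>x. x * _"] cong: if_cong)
  have right: "(A ** cmat_adjoint D) $ p $ q = A $ p $ q * c k q" for A :: "complex^'n^'n" and p q
    by (simp add: D_def matrix_mult_component if_distrib[of "\<lambda>x. _ * x"] if_distrib[of cnj] adj cong: if_cong)
  have "D ** cmat_adjoint D = mat 1"
    by (rule cmat_eqI, unfold right) (auto simp: D_def mat_def refl trans)
  then have "unitary_matrix D"
    using matrix_left_right_inverse unitary_matrix_def by blast
  moreover have "(\<chi> p q. A $ p $ q * c p q) = D ** A ** cmat_adjoint D" for A
  proof (rule cmat_eqI)
    fix p q
    have "(D ** A ** cmat_adjoint D) $ p $ q = A $ p $ q * (c p k * c k q)"
      by (simp add: left right)
    then show "(\<chi> p q. A $ p $ q * c p q) $ p $ q = (D ** A ** cmat_adjoint D) $ p $ q"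
      by (simp add: trans)
  qed
  ultimately show thesis by (rule that)
qed

subsection \<open>Preservers fixing the diagonal matrix units\<close>

locale diagonal_unitary_preserver = unital_unitary_preserver +
  assumes diag: "\<Phi> (matrix_unit i i) = matrix_unit i i"
begin

definition X where "X s i j = cmat_scale (cnj s) (F i j) + cmat_scale s (F j i)"

lemma X_component: "X s i j $ p $ q = cnj s * F i j $ p $ q + s * F j i $ p $ q"
  by (simp add: X_def)

lemma offdiag_support:
  assumes "i \<noteq> j" "(p, q) \<noteq> (i, j)" "(p, q) \<noteq> (j, i)"
  shows "F i j $ p $ q = 0"
proof -
  \<comment> \<open>These are the diagonal entries of \<open>?S\<close> when \<open>s\<close> has
    modulus 2. Only 1 + 4 sums to 5, which isolates the positions (i, j) and (j, i); modulus 1 would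
    also let (i, i) and (j, j) survive.\<close>
  define \<alpha> :: "'a \<Rightarrow> complex" where "\<alpha> p = (if p = i then 1 else if p = j then 4 else 0)" for p
  have X0: "X s i j $ p $ q = 0" if s: "s * cnj s = 4" for s
  proof -
    let ?S = "matrix_unit i i + cmat_scale 4 (matrix_unit j j)"
    have "?S ** X s i j + X s i j ** ?S = cmat_scale 5 (X s i j)"
      using two_by_two(1)[OF \<open>i \<noteq> j\<close>, of s] by (simp add: diag s X_def)
    then have "(?S ** X s i j) $ p $ q + (X s i j ** ?S) $ p $ q = 5 * X s i j $ p $ q"
      by (metis cmat_scale_component vector_add_component)
    moreover have "(?S ** X s i j) $ p $ q = \<alpha> p * X s i j $ p $ q"
      "(X s i j ** ?S) $ p $ q = \<alpha> q * X s i j $ p $ q"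
      using \<open>i \<noteq> j\<close> by (auto simp: \<alpha>_def matrix_mult_add_left matrix_add_ldistrib matrix_mult_cmat_scale_left
          matrix_mult_cmat_scale_right matrix_unit_mult_left matrix_unit_mult_right)
    ultimately have "(\<alpha> p + \<alpha> q - 5) * X s i j $ p $ q = 0"
      by (simp add: algebra_simps)
    moreover have "\<alpha> p + \<alpha> q - 5 \<noteq> 0"
      using assms by (auto simp: \<alpha>_def)
    ultimately show ?thesis by simp
  qed
  have "F i j $ p $ q + F j i $ p $ q = 0" "F j i $ p $ q - F i j $ p $ q = 0"
    using X0[of 2] X0[of "2 * \<i>"] unfolding X_component by (auto simp: algebra_simps)
  then show ?thesis by (simp add: eq_neg_iff_add_eq_0[symmetric])
qed

text \<open>\<open>g\<close> carries the conjugation part and \<open>b\<close> the transposed part.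
  In both, the indices name the entry of the image, so that both satisfy the same cocycle
  rule.\<close>

definition g where "g p q = F p q $ p $ q"
definition b where "b p q = F q p $ p $ q"

lemma g_refl: "g p p = 1" and b_refl: "b p p = 1"
  by (simp_all add: g_def b_def diag matrix_unit_component)

text \<open>By \<open>offdiag_support\<close> only \<open>F p q\<close> and \<open>F q p\<close>
  reach the entry (p, q). The diagonal is split off because \<open>g p p\<close> and
  \<open>b p p\<close> are both 1 and would count it twice.\<close>

lemma component:
  "\<Phi> A $ p $ q = (if p = q then A $ p $ p else A $ p $ q * g p q + A $ q $ p * b p q)"
proof -
  have F: "F i j $ p $ q = (if i = p then (if j = q then (if p = q then 1 else g p q) else 0) else 0)
      + (if i = q then (if j = p then (if p = q then 0 else b p q) else 0) else 0)" for i j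
    using offdiag_support[of i j p q]
    by (cases "i = j") (auto simp: diag matrix_unit_component g_def b_def)
  have "\<Phi> A = (\<Sum>i\<in>UNIV. \<Sum>j\<in>UNIV. cmat_scale (A $ i $ j) (F i j))"
    by (subst matrix_unit_expansion[of A]) (simp add: sum scale)
  then have "\<Phi> A $ p $ q = (\<Sum>i\<in>UNIV. \<Sum>j\<in>UNIV. A $ i $ j * F i j $ p $ q)"
    by simp
  also have "\<dots> = (\<Sum>i\<in>UNIV. \<Sum>j\<in>UNIV.
      (if j = q then (if i = p then A $ i $ j * (if p = q then 1 else g p q) else 0) else 0)
      + (if j = p then (if i = q then A $ i $ j * (if p = q then 0 else b p q) else 0) else 0))"
    by (intro sum.cong refl) (simp add: F)
  also have "\<dots> = (if p = q then A $ p $ p else A $ p $ q * g p q + A $ q $ p * b p q)"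
    by (simp add: sum.distrib)
  finally show ?thesis .
qed

text \<open>Self-adjointness in \<open>two_by_two\<close>, read at the entry (j, i):
  \<open>s = 1\<close> gives the sum of the two claims and \<open>s = \<i>\<close> their
  difference.\<close>

lemma pair_adjoint:
  assumes "i \<noteq> j"
  shows "g j i = cnj (g i j)" and "b j i = cnj (b i j)"
proof -
  have eq: "s * cnj (g i j) + cnj s * cnj (b i j) = cnj s * b j i + s * g j i" for s
  proof -
    have "cmat_adjoint (matrix_unit i i + cmat_scale (s * cnj s) (matrix_unit j j) + X s i j) $ j $ i
        = (matrix_unit i i + cmat_scale (s * cnj s) (matrix_unit j j) + X s i j) $ j $ i"
      using two_by_two(3)[OF assms, of s] by (simp add: diag X_def)
    then show ?thesis
      using assms by (simp add: matrix_unit_component X_component g_def b_def)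
  qed
  have "cnj (g i j) + cnj (b i j) = b j i + g j i"
    using eq[of 1] by simp
  moreover have "\<i> * (cnj (g i j) - cnj (b i j)) = \<i> * (g j i - b j i)"
    using eq[of \<i>] by (simp add: algebra_simps)
  then have "cnj (g i j) - cnj (b i j) = g j i - b j i" by simp
  ultimately show "g j i = cnj (g i j)" and "b j i = cnj (b i j)"
    using add_diff_eq_imp_eq[of "cnj (g i j)" "cnj (b i j)" "g j i" "b j i"] by (simp_all add: add.commute)
qed

text \<open>Together with \<open>pair_adjoint\<close> this says that exactly one of
  \<open>g i j\<close> and \<open>b i j\<close> is nonzero, and that it has modulus 1.\<close>

lemma pair_product:
  assumes "i \<noteq> j"
  shows "g i j * g j i + b i j * b j i = 1" "g i j * b j i = 0" "b i j * g j i = 0"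
proof -
  have eq: "(cnj s * g i j + s * b i j) * (cnj s * b j i + s * g j i) = s * cnj s" for s
  proof -
    let ?S = "matrix_unit i i + cmat_scale (s * cnj s) (matrix_unit j j)"
    have "?S ** ?S + X s i j ** X s i j = cmat_scale (1 + s * cnj s) ?S"
      using two_by_two(2)[OF assms, of s] by (simp add: diag X_def)
    then have "(?S ** ?S) $ i $ i + (X s i j ** X s i j) $ i $ i = (1 + s * cnj s) * ?S $ i $ i"
      by (metis cmat_scale_component vector_add_component)
    moreover have "(?S ** ?S) $ i $ i = 1" "?S $ i $ i = 1"
      using assms by (simp_all add: matrix_mult_add_left matrix_mult_cmat_scale_left
          matrix_unit_mult_left matrix_unit_component)
    moreover have "(X s i j ** X s i j) $ i $ i = X s i j $ i $ j * X s i j $ j $ i"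
    proof -
      have "X s i j $ i $ l = 0" if "l \<noteq> j" for l
        using assms that by (simp add: X_component offdiag_support)
      then show ?thesis
        unfolding matrix_mult_component by (subst sum.remove[of _ j]) (auto intro!: sum.neutral)
    qed
    ultimately have "X s i j $ i $ j * X s i j $ j $ i = s * cnj s"
      by (metis add_left_cancel mult.right_neutral)
    then show ?thesis
      by (simp add: X_component g_def b_def add.commute)
  qed
  \<comment> \<open>For s with conjugate t, the equation reads s t (A + B) + t^2 C + s^2 D = s t.
    The values 1 and \<open>\<i>\<close> separate A + B from C + D, and \<open>1 + \<i>\<close>
    separates C from D.\<close>
  define A B C D where defs: "A = g i j * g j i" "B = b i j * b j i" "C = g i j * b j i" "D = b i j * g j i"
  have 1: "(A + B) + (C + D) = 1"
    using eq[of 1] by (simp add: defs algebra_simps)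
  have "\<i> * \<i> * (C + D - (A + B)) = 1"
    using eq[of \<i>] by (simp add: defs algebra_simps)
  then have 2: "(A + B) - (C + D) = 1" by (simp add: algebra_simps)
  have "(1 - \<i>) * (1 - \<i>) * C + (1 + \<i>) * (1 - \<i>) * (A + B) + (1 + \<i>) * (1 + \<i>) * D = 2"
    using eq[of "1 + \<i>"] by (simp add: defs algebra_simps)
  then have "2 * ((A + B) + \<i> * (D - C)) = 2 * 1" by (simp add: algebra_simps)
  then have 3: "(A + B) + \<i> * (D - C) = 1" by (metis mult_left_cancel zero_neq_numeral)
  have AB: "A + B = 1"
    using add_diff_eq_imp_eq[of "A + B" "C + D" 1 0] 1 2 by simp
  then have "D + C = 0" "D - C = 0"
    using 1 3 by (simp_all add: add.commute)
  then have "C = 0" "D = 0"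
    using add_diff_eq_imp_eq[of D C 0 0] by simp_all
  with AB show "g i j * g j i + b i j * b j i = 1" "g i j * b j i = 0" "b i j * g j i = 0"
    by (simp_all only: defs)
qed

text \<open>Square identity for \<open>\<Phi>\<close> at \<open>e\<^sub>i + y e\<^sub>j + z e\<^sub>k\<close> with \<open>y\<close> and \<open>z\<close> unimodular;
  varying the phases separates the two cocycles.\<close>

lemma triple_product:
  assumes "i \<noteq> j" "j \<noteq> k" "i \<noteq> k"
  shows "g i j * g j k = g i k" "b i j * b j k = b i k"
proof -
  have eq: "(cnj y * g i j + y * b i j) * (y * cnj z * g j k + cnj y * z * b j k) = cnj z * g i k + z * b i k"
    if y: "y * cnj y = 1" and z: "z * cnj z = 1" for y z
  proof -
    define v :: "complex^'a" where "v = (\<chi> l. if l = i then 1 else if l = j then y else if l = k then z else 0)"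
    define M where "M = \<Phi> (outer_product v v)"
    have v: "v $ i = 1" "v $ j = y" "v $ k = z" "\<And>l. l \<notin> {i, j, k} \<Longrightarrow> v $ l = 0"
      using assms by (auto simp: v_def)
    have restrict: "(\<Sum>l\<in>UNIV. f l) = f i + f j + f k" if "\<And>l. l \<notin> {i, j, k} \<Longrightarrow> f l = 0" for f :: "'a \<Rightarrow> complex"
    proof -
      have "(\<Sum>l\<in>UNIV. f l) = (\<Sum>l\<in>{i, j, k}. f l)"
        using that by (intro sum.mono_neutral_right) auto
      then show ?thesis using assms by simp
    qed
    have "complex_of_real ((norm v)\<^sup>2) = 3"
      unfolding cinner_self[symmetric] cinner_def
      by (subst restrict) (simp_all add: v y z)
    then have "M ** M = cmat_scale 3 M"
      using rank_one(1)[of v] by (simp add: M_def)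
    then have "(M ** M) $ i $ k = 3 * M $ i $ k" by simp
    moreover have "M $ i $ l = 0" if "l \<notin> {i, j, k}" for l
      using v(4)[OF that] that by (simp add: M_def component)
    then have "(M ** M) $ i $ k = M $ i $ i * M $ i $ k + M $ i $ j * M $ j $ k + M $ i $ k * M $ k $ k"
      unfolding matrix_mult_component by (subst restrict) simp_all
    \<comment> \<open>Two of the three terms of the product are then \<open>M $ i $ k\<close>
      itself, and the factor 3 leaves exactly one copy.\<close>
    moreover have "M $ i $ i = 1" "M $ k $ k = 1"
      by (simp_all add: M_def component v z)
    ultimately have "M $ i $ j * M $ j $ k = M $ i $ k" by simp
    then show ?thesis
      using assms by (simp add: M_def component v mult_ac)
  qed
  \<comment> \<open>Passing from \<open>y = 1\<close> to \<open>y = \<i>\<close> changes the sign of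
    the mixed products \<open>C\<close> and \<open>D\<close> only; passing from \<open>z = 1\<close>
    to \<open>z = \<i>\<close> then separates \<open>A\<close>, \<open>G\<close> from
    \<open>B\<close>, \<open>H\<close>.\<close>
  define A B C D G H where defs: "A = g i j * g j k" "B = b i j * b j k" "C = g i j * b j k"
    "D = b i j * g j k" "G = g i k" "H = b i k"
  have 1: "(A + B) + (C + D) = G + H"
    using eq[of 1 1] by (simp add: defs algebra_simps)
  have 2: "(A + B) - (C + D) = G + H"
    using eq[of \<i> 1] by (simp add: defs algebra_simps)
  have "\<i> * ((B - A) + (C - D)) = \<i> * (H - G)"
    using eq[of 1 \<i>] by (simp add: defs algebra_simps)
  then have 3: "(B - A) + (C - D) = H - G" by simp
  have "\<i> * ((B - A) - (C - D)) = \<i> * (H - G)"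
    using eq[of \<i> \<i>] by (simp add: defs algebra_simps)
  then have 4: "(B - A) - (C - D) = H - G" by simp
  have "B + A = H + G" "B - A = H - G"
    using add_diff_eq_imp_eq[of "A + B" "C + D" "G + H" 0] add_diff_eq_imp_eq[of "B - A" "C - D" "H - G" 0]
      1 2 3 4 by (simp_all add: add.commute)
  then have "A = G" "B = H"
    using add_diff_eq_imp_eq by blast+
  then show "g i j * g j k = g i k" "b i j * b j k = b i k"
    by (simp_all add: defs)
qed

text \<open>A single nonzero \<open>g i j\<close> spreads: the cocycle rule makes row
  \<open>i\<close> nonzero, symmetry makes column \<open>i\<close> nonzero, and products through
  \<open>i\<close> reach every other pair. Exclusivity then kills \<open>b\<close> off the
  diagonal.\<close>

lemma dichotomy: "(\<forall>i j. i \<noteq> j \<longrightarrow> b i j = 0) \<or> (\<forall>i j. i \<noteq> j \<longrightarrow> g i j = 0)"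
proof (rule disjCI)
  have sym: "g j i \<noteq> 0" if "g i j \<noteq> 0" "i \<noteq> j" for i j
    using that pair_adjoint(1)[of i j] by simp
  have excl: "b i j = 0" if "g i j \<noteq> 0" "i \<noteq> j" for i j
    using pair_product(3)[of i j] sym[OF that] that by simp
  assume "\<not> (\<forall>i j. i \<noteq> j \<longrightarrow> g i j = 0)"
  then obtain i j where ij: "i \<noteq> j" "g i j \<noteq> 0" by blast
  have i: "g i k \<noteq> 0" if "k \<noteq> i" for k
  proof (cases "k = j")
    case False
    then have "g i k * g k j = g i j"
      using ij that by (intro triple_product) auto
    then show ?thesis using ij by force
  qed (use ij in simp)
  show "\<forall>k l. k \<noteq> l \<longrightarrow> b k l = 0"
  proof (intro allI impI)
    fix k l :: 'a assume "k \<noteq> l"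
    have "g k l \<noteq> 0"
    proof (cases "k = i \<or> l = i")
      case True
      then show ?thesis using i[of l] sym[OF i[of k]] \<open>k \<noteq> l\<close> by blast
    next
      case False
      then have "g k i * g i l = g k l"
        using \<open>k \<noteq> l\<close> by (intro triple_product) auto
      moreover have "g k i \<noteq> 0" "g i l \<noteq> 0"
        using False i sym[OF i[of k]] by auto
      ultimately show ?thesis by force
    qed
    then show "b k l = 0" using excl \<open>k \<noteq> l\<close> by blast
  qed
qed

lemma conjugation_or_transpose:
  obtains D where "unitary_matrix D"
    "(\<forall>A. \<Phi> A = D ** A ** cmat_adjoint D) \<or> (\<forall>A. \<Phi> A = D ** transpose A ** cmat_adjoint D)"
  using dichotomy
proof
  assume b0: "\<forall>i j. i \<noteq> j \<longrightarrow> b i j = 0"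
  have trans: "g p q * g q r = g p r" for p q r
  proof -
    consider "p = q" | "q = r" | "p \<noteq> q" "p = r" | "p \<noteq> q" "q \<noteq> r" "p \<noteq> r" by blast
    then show ?thesis
    proof cases
      \<comment> \<open>\<open>triple_product\<close> covers distinct indices only; for the closed
        path from \<open>p\<close> to \<open>q\<close> and back, the value 1 comes from
        \<open>pair_product\<close> with \<open>b\<close> vanishing.\<close>
      case 3
      then show ?thesis using pair_product(1)[of p q] b0 g_refl by simp
    next
      case 4
      then show ?thesis by (intro triple_product)
    qed (simp_all add: g_refl)
  qed
  have adj: "cnj (g p q) = g q p" for p q
    using pair_adjoint(1)[of p q] g_refl by (cases "p = q") auto
  obtain D where D: "unitary_matrix D" "\<And>A. (\<chi> p q. A $ p $ q * g p q) = D ** A ** cmat_adjoint D"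
    using cocycle_Hadamard_conjugation[where c = g, OF g_refl trans adj] by blast
  have "\<Phi> A = (\<chi> p q. A $ p $ q * g p q)" for A
    by (rule cmat_eqI) (simp add: component g_refl b0)
  then have "\<Phi> A = D ** A ** cmat_adjoint D" for A
    by (simp only: D(2))
  then show thesis
    using that[OF D(1)] by blast
next
  assume g0: "\<forall>i j. i \<noteq> j \<longrightarrow> g i j = 0"
  have trans: "b p q * b q r = b p r" for p q r
  proof -
    consider "p = q" | "q = r" | "p \<noteq> q" "p = r" | "p \<noteq> q" "q \<noteq> r" "p \<noteq> r" by blast
    then show ?thesis
    proof cases
      case 3
      then show ?thesis using pair_product(1)[of p q] g0 b_refl by simp
    next
      case 4
      then show ?thesis by (intro triple_product)
    qed (simp_all add: b_refl)
  qed
  have adj: "cnj (b p q) = b q p" for p q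
    using pair_adjoint(2)[of p q] b_refl by (cases "p = q") auto
  obtain D where D: "unitary_matrix D" "\<And>A. (\<chi> p q. A $ p $ q * b p q) = D ** A ** cmat_adjoint D"
    using cocycle_Hadamard_conjugation[where c = b, OF b_refl trans adj] by blast
  have "\<Phi> A = (\<chi> p q. transpose A $ p $ q * b p q)" for A
    by (rule cmat_eqI) (simp add: component b_refl g0 transpose_def)
  then have "\<Phi> A = D ** transpose A ** cmat_adjoint D" for A
    by (simp only: D(2))
  then show thesis
    using that[OF D(1)] by blast
qed

end

section \<open>Reduction of a general preserver to the normalised one\<close>

theorem corollary3:
  fixes \<Phi> :: "complex^'n^'n \<Rightarrow> complex^'n^'n"
  assumes "Vector_Spaces.linear cmat_scale cmat_scale \<Phi>"
  shows "preserves_extreme_points \<Phi> \<longleftrightarrow>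
    (\<exists>U V. unitary_matrix U \<and> unitary_matrix V \<and>
      ((\<forall>A. \<Phi> A = U ** A ** V) \<or> (\<forall>A. \<Phi> A = U ** transpose A ** V)))"
proof
  assume "preserves_extreme_points \<Phi>"
  then have unitary: "unitary_matrix (\<Phi> A)" if "unitary_matrix A" for A
    using that by (simp add: preserves_extreme_points_def extreme_point_iff_unitary_matrix)
  have add: "\<Phi> (A + B) = \<Phi> A + \<Phi> B" and scale: "\<Phi> (cmat_scale c A) = cmat_scale c (\<Phi> A)" for A B c
    using assms by (simp_all add: Vector_Spaces.linear_iff)
  have mult_unitary: "U ** (cmat_adjoint U ** A) = A" "A ** U ** cmat_adjoint U = A"
    if "unitary_matrix U" for U A :: "complex^'n^'n"
    using that by (simp_all add: unitary_matrix_def matrix_mul_assoc) (simp add: matrix_mul_assoc[symmetric])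
  define U where "U = \<Phi> (mat 1)"
  have "unitary_matrix (mat 1 :: complex^'n^'n)" by (simp add: unitary_matrix_def)
  then have U: "unitary_matrix U" unfolding U_def by (rule unitary)
  define \<Psi> where "\<Psi> A = cmat_adjoint U ** \<Phi> A" for A
  interpret \<Psi>: unital_unitary_preserver \<Psi>
  proof
    show "\<Psi> (mat 1) = mat 1"
      using U by (simp add: \<Psi>_def U_def unitary_matrix_def)
  qed (simp_all add: \<Psi>_def add scale matrix_add_ldistrib matrix_mult_cmat_scale_right
      unitary_matrix_mult unitary_matrix_adjoint unitary U)
  obtain W where W: "unitary_matrix W"
    and diag: "\<And>i. cmat_adjoint W ** \<Psi> (matrix_unit i i) ** W = matrix_unit i i"
    using \<Psi>.diag_simultaneously_diagonalizable by metis
  define \<Theta> where "\<Theta> A = cmat_adjoint W ** \<Psi> A ** W" for A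
  interpret \<Theta>: diagonal_unitary_preserver \<Theta>
  proof
    show "\<Theta> (mat 1) = mat 1"
      using W by (simp add: \<Theta>_def \<Psi>.one unitary_matrix_def)
    show "\<Theta> (matrix_unit i i) = matrix_unit i i" for i
      by (simp add: \<Theta>_def diag)
  qed (simp_all add: \<Theta>_def \<Psi>.add \<Psi>.scale matrix_add_ldistrib matrix_mult_add_left
      matrix_mult_cmat_scale_left matrix_mult_cmat_scale_right
      unitary_matrix_mult unitary_matrix_adjoint \<Psi>.unitary W)
  obtain D where D: "unitary_matrix D"
    and form: "(\<forall>A. \<Theta> A = D ** A ** cmat_adjoint D) \<or> (\<forall>A. \<Theta> A = D ** transpose A ** cmat_adjoint D)"
    using \<Theta>.conjugation_or_transpose by metis
  \<comment> \<open>Undoing the two normalisations, the conjugation by \<open>W\<close> and the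
    factor \<open>cmat_adjoint U\<close>, leaves unitary factors on both sides of
    \<open>\<Theta> A\<close>.\<close>
  have "\<Phi> A = U ** (W ** \<Theta> A ** cmat_adjoint W)" for A
  proof -
    have "W ** \<Theta> A ** cmat_adjoint W = W ** (cmat_adjoint W ** \<Psi> A) ** W ** cmat_adjoint W"
      by (simp add: \<Theta>_def matrix_mul_assoc)
    then show ?thesis by (simp add: mult_unitary W U \<Psi>_def)
  qed
  then have "(\<forall>A. \<Phi> A = (U ** W ** D) ** A ** (cmat_adjoint D ** cmat_adjoint W))
      \<or> (\<forall>A. \<Phi> A = (U ** W ** D) ** transpose A ** (cmat_adjoint D ** cmat_adjoint W))"
    using form by (auto simp: matrix_mul_assoc)
  moreover have "unitary_matrix (U ** W ** D)" "unitary_matrix (cmat_adjoint D ** cmat_adjoint W)"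
    by (simp_all add: unitary_matrix_mult unitary_matrix_adjoint U W D)
  ultimately show "\<exists>U V. unitary_matrix U \<and> unitary_matrix V \<and>
      ((\<forall>A. \<Phi> A = U ** A ** V) \<or> (\<forall>A. \<Phi> A = U ** transpose A ** V))"
    by blast
next
  assume "\<exists>U V. unitary_matrix U \<and> unitary_matrix V \<and>
      ((\<forall>A. \<Phi> A = U ** A ** V) \<or> (\<forall>A. \<Phi> A = U ** transpose A ** V))"
  then show "preserves_extreme_points \<Phi>"
    by (auto simp: preserves_extreme_points_def extreme_point_iff_unitary_matrix
        unitary_matrix_mult unitary_matrix_transpose)
qed

end
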